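(* There does not exist any MK-curve $C\subset\mathbb{P}^2_{\mathbb{C}}$ of degree $n \in \{6,\dots,24\}$ with only $E_{6}$ singularities.
   Context: ADE singularities of plane curves are those locally analytically equivalent to $A_k: x^2+y^{k+1}=0$ ($k\ge 1$), $D_k: x^2y+y^{k-1}=0$ ($k\geq 4$), $E_6: x^3+y^4=0$, $E_7: x^3+xy^3=0$, $E_8: x^3+y^5=0$. Let $C$ be a reduced plane curve of even degree with only ADE singularities, and let $X$ be the double cover of $\mathbb{P}^2_{\mathbb{C}}$ branched along $C$. Over each $p\in \mathrm{Sing}(C)$, $X$ has a rational double point of the same type. The Miyaoka-Kobayashi number of $p$ is $m(p)=3\left(e(E_p)-\frac{1}{\mathrm{ord}(G_p)}\right)-K(E_p)^2$, where $E_p$ is the exceptional curve over $p$ in the minimal resolution of $X$, $e$ is the topological Euler characteristic, $G_p$ is the associated small group, and $K(E_p)$ is the local canonical divisor (which is zero for rational double points). Explicitly, $m(A_k)=3(k+1)-\frac{3}{k+1}$ for $k\ge 1$, $m(D_k)=3(k+1)-\frac{3}{4(k-2)}$ for $k\ge 4$, $m(E_6)=\frac{167}{8}$, $m(E_7)=\frac{383}{16}$, $m(E_8)=\frac{1079}{40}$. Put $m(C)=\sum_{p\in \mathrm{Sing}(C)}m(p)$. MK-curve: a reduced curve $C\subset\mathbb{P}^2_{\mathbb{C}}$ of even degree $n\geq 6$ with only ADE singularities such that $m(C)=\frac{n}{2}(5n-6)$. (In particular MK-curves have even degree by definition.) *)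

theory Defs
  imports
    "HOL-Analysis.Analysis"
    "HOL-Library.Poly_Mapping"
    "HOL-Computational_Algebra.Squarefree"
begin

section \<open>Projective plane curves\<close>

text \<open>The polynomial ring in the variables indexed by \<open>'n\<close>: finitely supported maps from
  exponent vectors to coefficients, multiplied by convolution.\<close>

type_synonym 'n cpoly = "('n \<Rightarrow>\<^sub>0 nat) \<Rightarrow>\<^sub>0 complex"

definition poly_eval :: "'n::finite cpoly \<Rightarrow> complex ^ 'n \<Rightarrow> complex" where
  "poly_eval F v =
     (\<Sum>m\<in>Poly_Mapping.keys F.
        Poly_Mapping.lookup F m * (\<Prod>i\<in>UNIV. (v $ i) ^ Poly_Mapping.lookup m i))"

definition homogeneous :: "nat \<Rightarrow> 'n::finite cpoly \<Rightarrow> bool" where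
  "homogeneous n F \<longleftrightarrow>
     (\<forall>m\<in>Poly_Mapping.keys F. (\<Sum>i\<in>UNIV. Poly_Mapping.lookup m i) = n)"

definition proj_plane :: "(complex ^ 3) set set" where
  "proj_plane = {p. vec.subspace p \<and> vec.dim p = 1}"

text \<open>A reduced plane curve is given by its equation, unique up to a nonzero scalar; \<open>squarefree\<close>
  excludes the zero polynomial.\<close>

definition reduced_curve :: "nat \<Rightarrow> 3 cpoly \<Rightarrow> bool" where
  "reduced_curve n F \<longleftrightarrow> homogeneous n F \<and> squarefree F"

definition Sing :: "3 cpoly \<Rightarrow> (complex ^ 3) set set" where
  "Sing F = {p \<in> proj_plane. \<forall>v \<in> p - {0}.
     poly_eval F v = 0 \<and> (poly_eval F has_derivative (\<lambda>_. 0)) (at v)}"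


section \<open>Local analytic equivalence\<close>

text \<open>Holomorphy in several variables: the Frechet derivative exists and is complex linear, with
  \<open>a\<close> the vector of complex partial derivatives.\<close>

definition holomorphic_fun :: "(complex ^ 'n) set \<Rightarrow> (complex ^ 'n \<Rightarrow> complex) \<Rightarrow> bool" where
  "holomorphic_fun U f \<longleftrightarrow> open U \<and>
     (\<forall>z\<in>U. \<exists>a. (f has_derivative (\<lambda>w. \<Sum>i\<in>UNIV. a $ i * w $ i)) (at z))"

definition holomorphic_map ::
    "(complex ^ 'n) set \<Rightarrow> (complex ^ 'n \<Rightarrow> complex ^ 'm) \<Rightarrow> bool" where
  "holomorphic_map U \<phi> \<longleftrightarrow> (\<forall>i. holomorphic_fun U (\<lambda>z. \<phi> z $ i))"

definition biholomorphic ::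
    "(complex ^ 'n) set \<Rightarrow> (complex ^ 'n) set \<Rightarrow> (complex ^ 'n \<Rightarrow> complex ^ 'n) \<Rightarrow> bool" where
  "biholomorphic U V \<phi> \<longleftrightarrow> holomorphic_map U \<phi> \<and> \<phi> ` U = V \<and>
     (\<exists>\<psi>. holomorphic_map V \<psi> \<and> (\<forall>z\<in>U. \<psi> (\<phi> z) = z) \<and> (\<forall>w\<in>V. \<phi> (\<psi> w) = w))"

text \<open>Equivalence of the curve germs \<open>f = 0\<close> and \<open>g = 0\<close> at the origin: after a local analytic
  change of coordinates, the equations agree up to a unit.\<close>

definition locally_analytically_equivalent ::
    "(complex ^ 'n \<Rightarrow> complex) \<Rightarrow> (complex ^ 'n \<Rightarrow> complex) \<Rightarrow> bool" where
  "locally_analytically_equivalent f g \<longleftrightarrow>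
     (\<exists>U V \<phi> u. open U \<and> open V \<and> 0 \<in> U \<and> biholomorphic U V \<phi> \<and> \<phi> 0 = 0 \<and>
        holomorphic_fun U u \<and> (\<forall>z\<in>U. u z \<noteq> 0 \<and> f (\<phi> z) = u z * g z))"

text \<open>The equation of the curve in the affine chart \<open>(x, y) \<mapsto> [v + x a + y b]\<close> of the projective
  plane, for a basis \<open>v, a, b\<close>; the origin corresponds to the point \<open>[v]\<close>.\<close>

definition local_equation ::
    "3 cpoly \<Rightarrow> complex ^ 3 \<Rightarrow> complex ^ 3 \<Rightarrow> complex ^ 3 \<Rightarrow> complex ^ 2 \<Rightarrow> complex" where
  "local_equation F v a b = (\<lambda>z. poly_eval F (v + (z $ 1) *s a + (z $ 2) *s b))"


section \<open>ADE singularities\<close>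

datatype ADE = A nat | D nat | E6 | E7 | E8

fun valid_ADE :: "ADE \<Rightarrow> bool" where
  "valid_ADE (A k) \<longleftrightarrow> k \<ge> 1"
| "valid_ADE (D k) \<longleftrightarrow> k \<ge> 4"
| "valid_ADE E6 \<longleftrightarrow> True"
| "valid_ADE E7 \<longleftrightarrow> True"
| "valid_ADE E8 \<longleftrightarrow> True"

fun normal_form :: "ADE \<Rightarrow> complex ^ 2 \<Rightarrow> complex" where
  "normal_form (A k) z = (z $ 1) ^ 2 + (z $ 2) ^ (k + 1)"
| "normal_form (D k) z = (z $ 1) ^ 2 * z $ 2 + (z $ 2) ^ (k - 1)"
| "normal_form E6 z = (z $ 1) ^ 3 + (z $ 2) ^ 4"
| "normal_form E7 z = (z $ 1) ^ 3 + z $ 1 * (z $ 2) ^ 3"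
| "normal_form E8 z = (z $ 1) ^ 3 + (z $ 2) ^ 5"

definition has_ADE_type :: "3 cpoly \<Rightarrow> (complex ^ 3) set \<Rightarrow> ADE \<Rightarrow> bool" where
  "has_ADE_type F p T \<longleftrightarrow> valid_ADE T \<and>
     (\<exists>v a b. p = vec.span {v} \<and> vec.span {v, a, b} = UNIV \<and>
        locally_analytically_equivalent (local_equation F v a b) (normal_form T))"

text \<open>The ADE types are pairwise inequivalent, so the type of an ADE singularity is unique.\<close>

definition ADE_type :: "3 cpoly \<Rightarrow> (complex ^ 3) set \<Rightarrow> ADE" where
  "ADE_type F p = (THE T. has_ADE_type F p T)"


section \<open>The Miyaoka--Kobayashi number and MK-curves\<close>

text \<open>The exceptional curve of the minimal resolution of a rational double point of rank \<open>k\<close> is a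
  tree of \<open>k\<close> projective lines, so its Euler characteristic is \<open>2 k - (k - 1) = k + 1\<close>.\<close>

fun exceptional_euler :: "ADE \<Rightarrow> nat" where
  "exceptional_euler (A k) = k + 1"
| "exceptional_euler (D k) = k + 1"
| "exceptional_euler E6 = 7"
| "exceptional_euler E7 = 8"
| "exceptional_euler E8 = 9"

text \<open>Orders of the finite subgroups of \<open>SL(2)\<close> whose quotients are the rational double points:
  cyclic, binary dihedral, binary tetrahedral, octahedral and icosahedral.\<close>

fun small_group_order :: "ADE \<Rightarrow> nat" where
  "small_group_order (A k) = k + 1"
| "small_group_order (D k) = 4 * (k - 2)"
| "small_group_order E6 = 24"
| "small_group_order E7 = 48"
| "small_group_order E8 = 120"

text \<open>The term \<open>K\<^sup>2\<close> vanishes for rational double points.\<close>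

definition MK_number :: "ADE \<Rightarrow> real" where
  "MK_number T = 3 * (real (exceptional_euler T) - 1 / real (small_group_order T))"

lemma MK_number_explicit:
  "MK_number (A k) = 3 * (real k + 1) - 3 / (real k + 1)"
  "k \<ge> 4 \<Longrightarrow> MK_number (D k) = 3 * (real k + 1) - 3 / (4 * (real k - 2))"
  "MK_number E6 = 167 / 8"
  "MK_number E7 = 383 / 16"
  "MK_number E8 = 1079 / 40"
  by (simp_all add: MK_number_def of_nat_diff right_diff_distrib add.commute)

definition curve_MK_number :: "3 cpoly \<Rightarrow> real" where
  "curve_MK_number F = (\<Sum>p\<in>Sing F. MK_number (ADE_type F p))"

definition MK_curve :: "nat \<Rightarrow> 3 cpoly \<Rightarrow> bool" where
  "MK_curve n F \<longleftrightarrow> reduced_curve n F \<and> even n \<and> n \<ge> 6 \<and>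
     (\<forall>p\<in>Sing F. \<exists>T. has_ADE_type F p T) \<and>
     curve_MK_number F = real n / 2 * (5 * real n - 6)"

end

theory Submission
  imports Defs "HOL-Complex_Analysis.Cauchy_Integral_Formula"
begin

text \<open>Comparing \<open>m(C) = s * 167/8\<close> for \<open>s\<close> singular points of type \<open>E\<^sub>6\<close> with
  \<open>n/2 * (5n - 6)\<close> gives \<open>167 s = 4 n (5n - 6)\<close>. The prime \<open>167\<close> divides none of the factors on the
  right, since \<open>6 \<le> n \<le> 24\<close> implies \<open>0 < 5n - 6 < 167\<close>.

  What remains is that an \<open>E\<^sub>6\<close> point has no other ADE type. The equation of the curve vanishes to
  order \<open>3\<close> or \<open>4\<close> along every regular analytic arc through an \<open>E\<^sub>6\<close> point (the order is \<open>4\<close> iff the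
  arc is tangent to the cuspidal direction), whereas for any other type one of the coordinate axes of
  the normal form is an arc along which the order is \<open>2\<close>, \<open>5\<close> or infinite.\<close>

section \<open>Vanishing orders\<close>

text \<open>The order is read off from a limit at 0, not from a power series, so it applies to
  \<open>poly_eval F\<close> along an arc without first showing that composite holomorphic. A
  function vanishing near 0 has no order at all.\<close>

definition vanishing_order :: "(complex \<Rightarrow> complex) \<Rightarrow> nat \<Rightarrow> bool" where
  "vanishing_order g k \<longleftrightarrow> (\<exists>c. c \<noteq> 0 \<and> ((\<lambda>t. g t / t ^ k) \<longlongrightarrow> c) (at 0))"

lemma vanishing_order_cong:
  assumes "open S" "0 \<in> S" "\<And>t. t \<in> S \<Longrightarrow> g t = h t"
  shows "vanishing_order g k \<longleftrightarrow> vanishing_order h k"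
proof -
  have "eventually (\<lambda>t. g t / t ^ k = h t / t ^ k) (at 0)"
    using eventually_at_in_open'[OF assms(1,2)] by eventually_elim (simp add: assms(3))
  then have "((\<lambda>t. g t / t ^ k) \<longlongrightarrow> c) (at 0) \<longleftrightarrow> ((\<lambda>t. h t / t ^ k) \<longlongrightarrow> c) (at 0)" for c
    by (intro filterlim_cong refl)
  then show ?thesis
    unfolding vanishing_order_def by simp
qed

lemma vanishing_order_mult:
  assumes "vanishing_order g k" "(u \<longlongrightarrow> c) (at 0)" "c \<noteq> 0"
  shows "vanishing_order (\<lambda>t. u t * g t) k"
proof -
  obtain d where "d \<noteq> 0" "((\<lambda>t. g t / t ^ k) \<longlongrightarrow> d) (at 0)"
    using assms(1) unfolding vanishing_order_def by blast
  then have "((\<lambda>t. u t * (g t / t ^ k)) \<longlongrightarrow> c * d) (at 0)"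
    by (intro tendsto_mult assms)
  with \<open>d \<noteq> 0\<close> assms(3) show ?thesis
    unfolding vanishing_order_def by (intro exI[of _ "c * d"]) simp
qed

text \<open>If \<open>g t / t ^ k\<close> converges, then \<open>g t / t ^ j\<close> is
  \<open>t ^ (k - j)\<close> times a convergent function and tends to 0, which is not an admissible
  leading coefficient.\<close>

lemma not_vanishing_order_less:
  assumes "vanishing_order g k" "j < k"
  shows "\<not> vanishing_order g j"
proof
  assume "vanishing_order g j"
  then obtain d where d: "d \<noteq> 0" "((\<lambda>t. g t / t ^ j) \<longlongrightarrow> d) (at 0)"
    unfolding vanishing_order_def by blast
  obtain c where c: "((\<lambda>t. g t / t ^ k) \<longlongrightarrow> c) (at 0)"
    using assms(1) unfolding vanishing_order_def by blast
  have "((\<lambda>t. t ^ (k - j) * (g t / t ^ k)) \<longlongrightarrow> 0 ^ (k - j) * c) (at 0)"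
    by (intro tendsto_intros c)
  moreover have "eventually (\<lambda>t. t ^ (k - j) * (g t / t ^ k) = g t / t ^ j) (at (0::complex))"
    unfolding eventually_at_filter
    by (rule always_eventually) (use assms(2) in \<open>auto simp: power_diff field_simps\<close>)
  ultimately have "((\<lambda>t. g t / t ^ j) \<longlongrightarrow> 0) (at 0)"
    using assms(2) by (simp add: filterlim_cong power_0_left)
  with d show False
    using LIM_unique by blast
qed

lemma vanishing_order_unique:
  assumes "vanishing_order g j" "vanishing_order g k"
  shows "j = k"
  using assms not_vanishing_order_less by (metis linorder_neqE_nat)

lemma not_vanishing_order_0: "\<not> vanishing_order (\<lambda>_. 0) k"
  unfolding vanishing_order_def using LIM_const_eq by fastforce

lemma vanishing_order_power: "vanishing_order (\<lambda>t. t ^ k) k"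
proof -
  have "eventually (\<lambda>t. t ^ k / t ^ k = 1) (at (0::complex))"
    by (simp add: eventually_at_filter)
  then show ?thesis
    unfolding vanishing_order_def by (intro exI[of _ 1]) (simp add: tendsto_eventually)
qed

section \<open>Leading terms of holomorphic functions\<close>

lemma tendsto_divide_deriv:
  fixes x :: "complex \<Rightarrow> complex"
  assumes "x holomorphic_on S" "open S" "0 \<in> S" "x 0 = 0"
  shows "((\<lambda>t. x t / t) \<longlongrightarrow> deriv x 0) (at 0)"
proof -
  have "(x has_field_derivative deriv x 0) (at 0)"
    using assms holomorphic_derivI by blast
  then show ?thesis
    using assms(4) by (simp add: has_field_derivative_iff)
qed

text \<open>The quotient \<open>x t / t\<close> extends holomorphically over 0 with value
  \<open>deriv x 0 = 0\<close>, so the first-order statement applies once more to this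
  extension.\<close>

lemma tendsto_divide_square:
  fixes x :: "complex \<Rightarrow> complex"
  assumes "x holomorphic_on S" "open S" "0 \<in> S" "x 0 = 0" "deriv x 0 = 0"
  shows "\<exists>c. ((\<lambda>t. x t / t ^ 2) \<longlongrightarrow> c) (at 0)"
proof -
  define y where "y = (\<lambda>t. if t = 0 then deriv x 0 else (x t - x 0) / (t - 0))"
  have y: "y holomorphic_on S"
    unfolding y_def using assms by (intro pole_lemma_open)
  have "((\<lambda>t. y t / t) \<longlongrightarrow> deriv y 0) (at 0)"
    using y assms by (intro tendsto_divide_deriv) (auto simp: y_def)
  moreover have "eventually (\<lambda>t. y t / t = x t / t ^ 2) (at 0)"
    using assms by (auto simp: y_def eventually_at_filter power2_eq_square)
  ultimately show ?thesis
    by (intro exI) (rule Lim_transform_eventually)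
qed

text \<open>If \<open>x\<close> has a simple zero, the cube dominates and the order is 3. Otherwise
  \<open>x\<close> is O(t^2), so its cube is O(t^6), while regularity forces \<open>y\<close> to
  have a simple zero; the fourth power dominates and the order is 4.\<close>

lemma vanishing_order_cubic_plus_quartic:
  fixes x y :: "complex \<Rightarrow> complex"
  assumes x: "x holomorphic_on S" "x 0 = 0" and y: "y holomorphic_on S" "y 0 = 0"
    and S: "open S" "0 \<in> S" and reg: "deriv x 0 \<noteq> 0 \<or> deriv y 0 \<noteq> 0"
  shows "\<exists>k\<in>{3, 4}. vanishing_order (\<lambda>t. x t ^ 3 + y t ^ 4) k"
proof (cases "deriv x 0 = 0")
  case False
  have "((\<lambda>t. (x t / t) ^ 3 + t * (y t / t) ^ 4) \<longlongrightarrow> deriv x 0 ^ 3 + 0 * deriv y 0 ^ 4) (at 0)"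
    using assms by (intro tendsto_intros tendsto_divide_deriv)
  moreover have "eventually (\<lambda>t. (x t / t) ^ 3 + t * (y t / t) ^ 4 = (x t ^ 3 + y t ^ 4) / t ^ 3) (at 0)"
    by (auto simp: eventually_at_filter field_simps power_divide eval_nat_numeral)
  ultimately have "vanishing_order (\<lambda>t. x t ^ 3 + y t ^ 4) 3"
    unfolding vanishing_order_def using False
    by (intro exI[of _ "deriv x 0 ^ 3"]) (simp add: filterlim_cong)
  then show ?thesis by blast
next
  case True
  then obtain c where c: "((\<lambda>t. x t / t ^ 2) \<longlongrightarrow> c) (at 0)"
    using tendsto_divide_square assms by blast
  \<comment> \<open>The limit \<open>c\<close> may be zero: the cubic term carries a spare factor
    \<open>t ^ 2\<close> and disappears in either case.\<close>
  have "((\<lambda>t. t ^ 2 * (x t / t ^ 2) ^ 3 + (y t / t) ^ 4) \<longlongrightarrow> 0 ^ 2 * c ^ 3 + deriv y 0 ^ 4) (at 0)"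
    using assms c by (intro tendsto_intros tendsto_divide_deriv)
  moreover have "eventually (\<lambda>t. t ^ 2 * (x t / t ^ 2) ^ 3 + (y t / t) ^ 4 = (x t ^ 3 + y t ^ 4) / t ^ 4) (at 0)"
    by (auto simp: eventually_at_filter field_simps power_divide eval_nat_numeral)
  ultimately have "vanishing_order (\<lambda>t. x t ^ 3 + y t ^ 4) 4"
    unfolding vanishing_order_def using True reg
    by (intro exI[of _ "deriv y 0 ^ 4"]) (simp add: filterlim_cong)
  then show ?thesis by blast
qed

section \<open>Holomorphic arcs\<close>

definition holomorphic_arc :: "complex set \<Rightarrow> (complex \<Rightarrow> complex ^ 'n) \<Rightarrow> bool" where
  "holomorphic_arc S \<gamma> \<longleftrightarrow> open S \<and> 0 \<in> S \<and> (\<forall>i. (\<lambda>t. \<gamma> t $ i) holomorphic_on S)"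

definition velocity :: "(complex \<Rightarrow> complex ^ 'n) \<Rightarrow> complex ^ 'n" where
  "velocity \<gamma> = (\<chi> i. deriv (\<lambda>t. \<gamma> t $ i) 0)"

lemma velocity_nth [simp]: "velocity \<gamma> $ i = deriv (\<lambda>t. \<gamma> t $ i) 0"
  by (simp add: velocity_def)

lemma velocity_cong:
  assumes "open S" "0 \<in> S" "\<And>t. t \<in> S \<Longrightarrow> \<gamma> t = \<delta> t"
  shows "velocity \<gamma> = velocity \<delta>"
proof -
  have "eventually (\<lambda>t. \<gamma> t = \<delta> t) (nhds 0)"
    using assms eventually_nhds by blast
  then have "deriv (\<lambda>t. \<gamma> t $ i) 0 = deriv (\<lambda>t. \<delta> t $ i) 0" for i
    by (intro deriv_cong_ev) (auto elim: eventually_mono)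
  then show ?thesis
    by (simp add: vec_eq_iff)
qed

text \<open>A vector-valued map is the sum of its components composed with the bounded linear
  embeddings \<open>axis i\<close>, so componentwise derivatives add up.\<close>

lemma has_derivative_componentwise_vec:
  fixes f :: "'a::real_normed_vector \<Rightarrow> 'b::real_normed_vector ^ 'n"
  assumes "\<And>i. ((\<lambda>x. f x $ i) has_derivative (\<lambda>h. f' h $ i)) (at x)"
  shows "(f has_derivative f') (at x)"
proof -
  have ax: "bounded_linear (axis i :: 'b \<Rightarrow> 'b ^ 'n)" for i
  proof
    have "norm (axis i x :: 'b ^ 'n) \<le> norm x" for x :: 'b
    proof -
      have "norm (axis i x :: 'b ^ 'n) \<le> (\<Sum>j\<in>UNIV. norm ((axis i x :: 'b ^ 'n) $ j))"
        unfolding norm_vec_def by (intro L2_set_le_sum) simp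
      also have "\<dots> = norm x"
        by (simp add: axis_def if_distrib[of norm] cong: if_cong)
      finally show ?thesis .
    qed
    then show "\<exists>K. \<forall>x::'b. norm (axis i x :: 'b ^ 'n) \<le> norm x * K"
      by (intro exI[of _ 1]) simp
  qed (auto simp: axis_def vec_eq_iff)
  have sum_axis: "(\<Sum>i\<in>UNIV. axis i (v $ i)) = v" for v :: "'b ^ 'n"
    by (simp add: vec_eq_iff axis_def)
  have "((\<lambda>x. \<Sum>i\<in>UNIV. axis i (f x $ i)) has_derivative (\<lambda>h. \<Sum>i\<in>UNIV. axis i (f' h $ i))) (at x)"
    by (intro has_derivative_sum bounded_linear.has_derivative[OF ax] assms)
  then show ?thesis
    by (simp add: sum_axis)
qed

lemma holomorphic_arc_has_derivative:
  assumes "holomorphic_arc S \<gamma>" "t \<in> S"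
  shows "(\<gamma> has_derivative (\<lambda>h. \<chi> i. deriv (\<lambda>t. \<gamma> t $ i) t * h)) (at t)"
proof (rule has_derivative_componentwise_vec)
  fix i
  show "((\<lambda>t. \<gamma> t $ i) has_derivative (\<lambda>h. (\<chi> i. deriv (\<lambda>t. \<gamma> t $ i) t * h) $ i)) (at t)"
    using assms holomorphic_derivI[of "\<lambda>t. \<gamma> t $ i" S t]
    by (simp add: holomorphic_arc_def has_field_derivative_def)
qed

lemma continuous_on_holomorphic_arc:
  assumes "holomorphic_arc S \<gamma>"
  shows "continuous_on S \<gamma>"
  using assms holomorphic_arc_has_derivative
  by (meson continuous_at_imp_continuous_on has_derivative_continuous)

lemma holomorphic_arc_restrict:
  assumes "holomorphic_arc S \<gamma>" "open T" "\<gamma> 0 \<in> T"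
  shows "holomorphic_arc (S \<inter> \<gamma> -` T) \<gamma>"
proof -
  have "open (S \<inter> \<gamma> -` T)"
    using assms unfolding holomorphic_arc_def
    by (intro continuous_open_preimage continuous_on_holomorphic_arc[OF assms(1)]) auto
  moreover have "(\<lambda>t. \<gamma> t $ i) holomorphic_on S \<inter> \<gamma> -` T" for i
    using assms(1) unfolding holomorphic_arc_def by (blast intro: holomorphic_on_subset)
  ultimately show ?thesis
    using assms unfolding holomorphic_arc_def by simp
qed

section \<open>Arcs under holomorphic and linear maps\<close>

lemma holomorphic_fun_comp_arc:
  assumes f: "holomorphic_fun U f" and \<gamma>: "holomorphic_arc S \<gamma>" "\<gamma> ` S \<subseteq> U"
  shows "(\<lambda>t. f (\<gamma> t)) holomorphic_on S"
    and "velocity \<gamma> = 0 \<Longrightarrow> deriv (\<lambda>t. f (\<gamma> t)) 0 = 0"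
proof -
  \<comment> \<open>The coefficients \<open>a\<close> may stay anonymous: both claims use only that
    the derivative of the composite exists and is a linear form in the velocity of the arc.\<close>
  have chain: "\<exists>a. ((\<lambda>t. f (\<gamma> t)) has_field_derivative
      (\<Sum>i\<in>UNIV. a $ i * deriv (\<lambda>t. \<gamma> t $ i) t)) (at t)" if "t \<in> S" for t
  proof -
    have "\<gamma> t \<in> U"
      using \<gamma>(2) that by blast
    then obtain a where a: "(f has_derivative (\<lambda>w. \<Sum>i\<in>UNIV. a $ i * w $ i)) (at (\<gamma> t))"
      using f unfolding holomorphic_fun_def by blast
    have "((\<lambda>t. f (\<gamma> t)) has_derivative
        (\<lambda>h. \<Sum>i\<in>UNIV. a $ i * (\<chi> i. deriv (\<lambda>t. \<gamma> t $ i) t * h) $ i)) (at t)"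
      by (rule has_derivative_compose[OF holomorphic_arc_has_derivative[OF \<gamma>(1) that] a])
    then have "((\<lambda>t. f (\<gamma> t)) has_field_derivative
        (\<Sum>i\<in>UNIV. a $ i * deriv (\<lambda>t. \<gamma> t $ i) t)) (at t)"
      unfolding has_field_derivative_def
      by (rule has_derivative_eq_rhs, intro ext)
        (simp only: vec_lambda_beta sum_distrib_right mult.assoc)
    then show ?thesis by blast
  qed
  have S: "open S" "0 \<in> S"
    using \<gamma>(1) by (simp_all add: holomorphic_arc_def)
  have "(\<lambda>t. f (\<gamma> t)) field_differentiable at t" if "t \<in> S" for t
    unfolding field_differentiable_def using chain[OF that] by (elim exE) (rule exI)
  then show "(\<lambda>t. f (\<gamma> t)) holomorphic_on S"
    by (intro holomorphic_onI) (rule field_differentiable_at_within)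
  show "deriv (\<lambda>t. f (\<gamma> t)) 0 = 0" if "velocity \<gamma> = 0"
  proof -
    have zero: "deriv (\<lambda>t. \<gamma> t $ i) 0 = 0" for i
      using arg_cong[OF that, of "\<lambda>v. v $ i"] by simp
    obtain a where "((\<lambda>t. f (\<gamma> t)) has_field_derivative
        (\<Sum>i\<in>UNIV. a $ i * deriv (\<lambda>t. \<gamma> t $ i) 0)) (at 0)"
      using chain[OF S(2)] by (elim exE)
    from DERIV_imp_deriv[OF this] show ?thesis
      by (simp add: zero)
  qed
qed

lemma holomorphic_map_comp_arc:
  assumes "holomorphic_map U \<phi>" "holomorphic_arc S \<gamma>" "\<gamma> ` S \<subseteq> U"
  shows "holomorphic_arc S (\<lambda>t. \<phi> (\<gamma> t))"
    and "velocity \<gamma> = 0 \<Longrightarrow> velocity (\<lambda>t. \<phi> (\<gamma> t)) = 0"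
proof -
  have comp: "holomorphic_fun U (\<lambda>z. \<phi> z $ i)" for i
    using assms(1) by (simp add: holomorphic_map_def)
  show "holomorphic_arc S (\<lambda>t. \<phi> (\<gamma> t))"
    using assms(2) holomorphic_fun_comp_arc(1)[OF comp assms(2,3)]
    unfolding holomorphic_arc_def by blast
  show "velocity (\<lambda>t. \<phi> (\<gamma> t)) = 0" if "velocity \<gamma> = 0"
    using holomorphic_fun_comp_arc(2)[OF comp assms(2,3) that] by (simp add: vec_eq_iff)
qed

text \<open>If the image arc had velocity 0, applying \<open>\<psi>\<close> would give an arc of
  velocity 0; but that arc is \<open>\<gamma>\<close> again. This replaces a Jacobian argument, and
  it serves for both directions of a biholomorphic map.\<close>

lemma inverse_pair_comp_arc:
  assumes "holomorphic_map U \<phi>" "holomorphic_map V \<psi>"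
    and "\<And>z. z \<in> U \<Longrightarrow> \<phi> z \<in> V \<and> \<psi> (\<phi> z) = z"
    and \<gamma>: "holomorphic_arc S \<gamma>" "\<gamma> ` S \<subseteq> U" "velocity \<gamma> \<noteq> 0"
  shows "holomorphic_arc S (\<lambda>t. \<phi> (\<gamma> t))" and "velocity (\<lambda>t. \<phi> (\<gamma> t)) \<noteq> 0"
proof -
  show arc: "holomorphic_arc S (\<lambda>t. \<phi> (\<gamma> t))"
    by (rule holomorphic_map_comp_arc(1)[OF assms(1) \<gamma>(1,2)])
  have "velocity (\<lambda>t. \<psi> (\<phi> (\<gamma> t))) = velocity \<gamma>"
    using \<gamma> assms(3) by (intro velocity_cong[of S]) (simp_all add: holomorphic_arc_def image_subset_iff)
  with \<gamma>(3) show "velocity (\<lambda>t. \<phi> (\<gamma> t)) \<noteq> 0"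
    using holomorphic_map_comp_arc(2)[OF assms(2) arc] assms(3) \<gamma>(2) by (force simp: image_subset_iff)
qed

lemma holomorphic_arc_matrix_vector_mult:
  fixes M :: "complex ^ 'n ^ 'm"
  assumes "holomorphic_arc S \<gamma>"
  shows "holomorphic_arc S (\<lambda>t. M *v \<gamma> t)" and "velocity (\<lambda>t. M *v \<gamma> t) = M *v velocity \<gamma>"
proof -
  have hol: "(\<lambda>t. \<gamma> t $ j) holomorphic_on S" for j
    using assms by (simp add: holomorphic_arc_def)
  then show "holomorphic_arc S (\<lambda>t. M *v \<gamma> t)"
    using assms by (auto simp: holomorphic_arc_def matrix_vector_mult_def intro!: holomorphic_intros)
  have "((\<lambda>t. \<gamma> t $ j) has_field_derivative deriv (\<lambda>t. \<gamma> t $ j) 0) (at 0)" for j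
    using assms hol holomorphic_derivI unfolding holomorphic_arc_def by blast
  then have "((\<lambda>t. \<Sum>j\<in>UNIV. M $ i $ j * \<gamma> t $ j) has_field_derivative
      (\<Sum>j\<in>UNIV. M $ i $ j * deriv (\<lambda>t. \<gamma> t $ j) 0)) (at 0)" for i
    by (intro DERIV_sum DERIV_cmult)
  then show "velocity (\<lambda>t. M *v \<gamma> t) = M *v velocity \<gamma>"
    by (simp add: vec_eq_iff matrix_vector_mult_def DERIV_imp_deriv)
qed

section \<open>The order of the equation of a curve along an arc\<close>

lemma poly_eval_scale:
  assumes "homogeneous n F"
  shows "poly_eval F (c *s v) = c ^ n * poly_eval F v"
proof -
  have "(\<Prod>i\<in>UNIV. ((c *s v) $ i) ^ Poly_Mapping.lookup m i) =
      c ^ n * (\<Prod>i\<in>UNIV. (v $ i) ^ Poly_Mapping.lookup m i)" if "m \<in> Poly_Mapping.keys F" for m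
    using assms that
    by (simp add: homogeneous_def power_mult_distrib prod.distrib flip: power_sum)
  then show ?thesis
    by (simp add: poly_eval_def sum_distrib_left mult.left_commute)
qed

text \<open>Three vectors spanning a space of dimension 3 are the columns of an invertible matrix
  \<open>N\<close>; its inverse \<open>M\<close> reads off coordinates in this frame.\<close>

lemma projective_frame_coordinates:
  fixes v a b :: "complex ^ 3"
  assumes "vec.span {v, a, b} = UNIV"
  obtains M :: "complex ^ 3 ^ 3" where
    "\<And>x. x = (M *v x) $ 1 *s v + (M *v x) $ 2 *s a + (M *v x) $ 3 *s b"
    "\<And>r s t. M *v (r *s v + s *s a + t *s b) = vector [r, s, t]"
proof -
  \<comment> \<open>\<open>vector [v, a, b]\<close> has the frame vectors as rows, hence the
    transpose.\<close>
  define N :: "complex ^ 3 ^ 3" where "N = transpose (vector [v, a, b])"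
  have N: "N *v w = w $ 1 *s v + w $ 2 *s a + w $ 3 *s b" for w
    by (simp add: N_def vec_eq_iff matrix_vector_mult_def transpose_def sum_3 mult.commute)
  have "surj ((*v) N)"
  unfolding surj_def
  proof
    fix x :: "complex ^ 3"
    have "x \<in> vec.span {v, a, b}" using assms by simp
    then obtain r s t where "x - r *s v - s *s a = t *s b"
      by (auto simp: vec.span_breakdown_eq vec.span_singleton)
    then have "x = N *v vector [r, s, t]"
      by (simp add: N algebra_simps)
    then show "\<exists>w. x = N *v w" by metis
  qed
  then obtain M where M: "N ** M = mat 1"
    using matrix_right_invertible_surjective by blast
  then have M': "M ** N = mat 1"
    by (simp add: matrix_left_right_inverse)
  show ?thesis
  proof (rule that)
    show "x = (M *v x) $ 1 *s v + (M *v x) $ 2 *s a + (M *v x) $ 3 *s b" for x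
      using N[of "M *v x"] M by (simp add: matrix_vector_mul_assoc)
    show "M *v (r *s v + s *s a + t *s b) = vector [r, s, t]" for r s t
    proof -
      have "r *s v + s *s a + t *s b = N *v vector [r, s, t]"
        by (simp add: N)
      then show ?thesis
        using M' by (simp add: matrix_vector_mul_assoc)
    qed
  qed
qed

text \<open>This is a lift to homogeneous coordinates of an arc through \<open>p\<close> in the
  plane. The tangent space there is modelled on the quotient of the ambient space by
  \<open>p\<close>, so a velocity outside \<open>p\<close> says that the projected arc is immersed
  at 0. No affine chart enters, which allows two charts at \<open>p\<close> to be compared.\<close>

definition regular_arc :: "(complex ^ 3) set \<Rightarrow> complex set \<Rightarrow> (complex \<Rightarrow> complex ^ 3) \<Rightarrow> bool" where
  "regular_arc p S \<Gamma> \<longleftrightarrow> holomorphic_arc S \<Gamma> \<and> \<Gamma> 0 \<in> p - {0} \<and> velocity \<Gamma> \<notin> p"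

lemma vanishing_order_unit_mult:
  assumes "holomorphic_fun U u" "holomorphic_arc S \<gamma>" "\<gamma> ` S \<subseteq> U" "u (\<gamma> 0) \<noteq> 0"
    and "vanishing_order g k"
  shows "vanishing_order (\<lambda>t. u (\<gamma> t) * g t) k"
proof (rule vanishing_order_mult)
  have "(\<lambda>t. u (\<gamma> t)) holomorphic_on S"
    using assms by (intro holomorphic_fun_comp_arc)
  then have "isCont (\<lambda>t. u (\<gamma> t)) 0"
    using assms(2) unfolding holomorphic_arc_def
    by (intro field_differentiable_imp_continuous_at holomorphic_on_imp_differentiable_at) auto
  then show "((\<lambda>t. u (\<gamma> t)) \<longlongrightarrow> u (\<gamma> 0)) (at 0)"
    by (simp add: isCont_def)
qed (use assms in auto)

text \<open>Dividing the frame coordinates of \<open>\<Gamma>\<close> by the first one, which is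
  nonzero near 0, gives the affine arc \<open>\<zeta>\<close>. By homogeneity the two equations
  along the arcs differ by the n-th power of that coordinate, a unit, so orders carry over.\<close>

lemma homogeneous_order_affine_chart:
  assumes F: "homogeneous n F"
    and \<Gamma>: "regular_arc (vec.span {v}) S \<Gamma>" and span: "vec.span {v, a, b} = UNIV"
  obtains T \<zeta> where "holomorphic_arc T \<zeta>" "\<zeta> 0 = 0" "velocity \<zeta> \<noteq> 0"
    "\<And>k. vanishing_order (\<lambda>t. local_equation F v a b (\<zeta> t)) k \<Longrightarrow>
         vanishing_order (\<lambda>t. poly_eval F (\<Gamma> t)) k"
proof -
  obtain M :: "complex ^ 3 ^ 3" where
    M1: "\<And>x. x = (M *v x) $ 1 *s v + (M *v x) $ 2 *s a + (M *v x) $ 3 *s b" and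
    M2: "\<And>r s t. M *v (r *s v + s *s a + t *s b) = vector [r, s, t]"
    using projective_frame_coordinates[OF span] by blast
  define \<delta> where "\<delta> t = M *v \<Gamma> t" for t
  have arc\<Gamma>: "holomorphic_arc S \<Gamma>"
    using \<Gamma> by (simp add: regular_arc_def)
  have \<delta>: "holomorphic_arc S \<delta>" and vel\<delta>: "velocity \<delta> = M *v velocity \<Gamma>"
    using holomorphic_arc_matrix_vector_mult[OF arc\<Gamma>, of M] by (simp_all add: \<delta>_def[abs_def])
  obtain c where c: "\<Gamma> 0 = c *s v" "c \<noteq> 0"
    using \<Gamma> by (auto simp: regular_arc_def vec.span_singleton)
  have "\<delta> 0 = vector [c, 0, 0]"
    using M2[of c 0 0] c by (simp add: \<delta>_def)
  then have \<delta>0: "\<delta> 0 $ 1 = c" "\<delta> 0 $ 2 = 0" "\<delta> 0 $ 3 = 0"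
    by simp_all
  have transversal: "deriv (\<lambda>t. \<delta> t $ 2) 0 \<noteq> 0 \<or> deriv (\<lambda>t. \<delta> t $ 3) 0 \<noteq> 0"
  proof (rule ccontr)
    assume "\<not> ?thesis"
    then have "velocity \<Gamma> = velocity \<delta> $ 1 *s v"
      using M1[of "velocity \<Gamma>"] by (simp flip: vel\<delta>)
    then have "velocity \<Gamma> \<in> vec.span {v}"
      by (metis vec.span_base vec.span_scale singletonI)
    then show False
      using \<Gamma> by (simp add: regular_arc_def)
  qed
  define T where "T = S \<inter> \<delta> -` {x. x $ 1 \<noteq> 0}"
  have "open {x :: complex ^ 3. x $ 1 \<noteq> 0}"
    by (intro open_Collect_neq continuous_intros)
  then have T: "holomorphic_arc T \<delta>"
    unfolding T_def using \<delta> c \<delta>0 by (intro holomorphic_arc_restrict) auto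
  then have open_T: "open T" "0 \<in> T" and hol: "(\<lambda>t. \<delta> t $ i) holomorphic_on T" for i
    by (simp_all add: holomorphic_arc_def)
  have nz: "\<delta> t $ 1 \<noteq> 0" if "t \<in> T" for t
    using that by (simp add: T_def)
  define \<zeta> :: "complex \<Rightarrow> complex ^ 2" where
    "\<zeta> t = vector [\<delta> t $ 2 / \<delta> t $ 1, \<delta> t $ 3 / \<delta> t $ 1]" for t
  \<comment> \<open>In the quotient rule the term with the derivative of the denominator drops out
    because the numerator vanishes at 0. Thus transversality of \<open>\<delta>\<close> passes to
    \<open>\<zeta>\<close>.\<close>
  have quotient: "deriv (\<lambda>t. \<delta> t $ i / \<delta> t $ 1) 0 = deriv (\<lambda>t. \<delta> t $ i) 0 / c"
    if "\<delta> 0 $ i = 0" for i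
  proof -
    have "((\<lambda>t. \<delta> t $ j) has_field_derivative deriv (\<lambda>t. \<delta> t $ j) 0) (at 0)" for j
      using hol open_T by (rule holomorphic_derivI)
    from DERIV_imp_deriv[OF DERIV_divide[OF this this]] show ?thesis
      using that c \<delta>0 by simp
  qed
  show ?thesis
  proof (rule that)
    show "holomorphic_arc T \<zeta>"
      unfolding holomorphic_arc_def
      using open_T nz by (auto simp: \<zeta>_def forall_2 intro!: holomorphic_intros hol)
    show "\<zeta> 0 = 0"
      by (simp add: \<zeta>_def \<delta>0 vec_eq_iff forall_2)
    show "velocity \<zeta> \<noteq> 0"
      using transversal c by (simp add: \<zeta>_def vec_eq_iff forall_2 quotient \<delta>0)
    fix k
    assume "vanishing_order (\<lambda>t. local_equation F v a b (\<zeta> t)) k"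
    moreover have "((\<lambda>t. (\<delta> t $ 1) ^ n) \<longlongrightarrow> (\<delta> 0 $ 1) ^ n) (at 0)"
      using continuous_on_holomorphic_arc[OF T] open_T
      by (intro tendsto_intros) (metis continuous_on_eq_continuous_at isCont_def)
    ultimately have "vanishing_order (\<lambda>t. (\<delta> t $ 1) ^ n * local_equation F v a b (\<zeta> t)) k"
      by (rule vanishing_order_mult) (use c \<delta>0 in simp)
    moreover have "(\<delta> t $ 1) ^ n * local_equation F v a b (\<zeta> t) = poly_eval F (\<Gamma> t)" if "t \<in> T" for t
    proof -
      have "\<delta> t $ 1 *s (v + \<zeta> t $ 1 *s a + \<zeta> t $ 2 *s b) = \<Gamma> t"
        using M1[of "\<Gamma> t"] nz[OF that]
        by (simp add: \<zeta>_def vec.scale_right_distrib flip: \<delta>_def)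
      then show ?thesis
        unfolding local_equation_def by (metis poly_eval_scale[OF F])
    qed
    ultimately show "vanishing_order (\<lambda>t. poly_eval F (\<Gamma> t)) k"
      by (rule iffD1[OF vanishing_order_cong[OF open_T], rotated])
  qed
qed

section \<open>Orders along regular arcs at \<open>E6\<close> points and at points of other
  types\<close>

text \<open>The arc is moved into an affine chart and then by \<open>\<psi>\<close> into the
  coordinates of the normal form. It still passes through the origin with nonzero velocity, so the
  cubic-plus-quartic computation applies; the unit \<open>u\<close> leaves the order
  unchanged.\<close>

lemma E6_vanishing_order:
  assumes F: "homogeneous n F" and E6: "has_ADE_type F p E6" and \<Gamma>: "regular_arc p S \<Gamma>"
  shows "\<exists>k\<in>{3, 4}. vanishing_order (\<lambda>t. poly_eval F (\<Gamma> t)) k"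
proof -
  obtain v a b where p: "p = vec.span {v}" and span: "vec.span {v, a, b} = UNIV"
    and equiv: "locally_analytically_equivalent (local_equation F v a b) (normal_form E6)"
    using E6 unfolding has_ADE_type_def by blast
  obtain T \<zeta> where \<zeta>: "holomorphic_arc T \<zeta>" "\<zeta> 0 = 0" "velocity \<zeta> \<noteq> 0"
    and order: "\<And>k. vanishing_order (\<lambda>t. local_equation F v a b (\<zeta> t)) k \<Longrightarrow>
         vanishing_order (\<lambda>t. poly_eval F (\<Gamma> t)) k"
    using homogeneous_order_affine_chart[OF F \<Gamma>[unfolded p] span] by metis
  obtain U V \<phi> u where UV: "open U" "open V" "0 \<in> U" "biholomorphic U V \<phi>" "\<phi> 0 = 0"
    and u: "holomorphic_fun U u" "\<And>z. z \<in> U \<Longrightarrow> u z \<noteq> 0"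
    and eq: "\<And>z. z \<in> U \<Longrightarrow> local_equation F v a b (\<phi> z) = u z * normal_form E6 z"
    using equiv unfolding locally_analytically_equivalent_def by blast
  obtain \<psi> where \<phi>: "holomorphic_map U \<phi>" "\<phi> ` U = V" and \<psi>: "holomorphic_map V \<psi>"
    "\<And>z. z \<in> U \<Longrightarrow> \<psi> (\<phi> z) = z" "\<And>w. w \<in> V \<Longrightarrow> \<phi> (\<psi> w) = w"
    using UV(4) unfolding biholomorphic_def by blast
  have \<psi>V: "\<psi> w \<in> U \<and> \<phi> (\<psi> w) = w" if "w \<in> V" for w
    using that \<phi>(2) \<psi> by auto
  \<comment> \<open>Parameters are restricted so that the arc stays in the domain of
    \<open>\<psi>\<close>.\<close>
  define R where "R = T \<inter> \<zeta> -` V"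
  have "0 \<in> V"
    using \<phi>(2) UV(3,5) by force
  then have R: "holomorphic_arc R \<zeta>" "\<zeta> ` R \<subseteq> V"
    unfolding R_def using \<zeta> UV by (auto intro: holomorphic_arc_restrict)
  define w where "w t = \<psi> (\<zeta> t)" for t
  have w: "holomorphic_arc R w" "velocity w \<noteq> 0"
    unfolding w_def by (rule inverse_pair_comp_arc[OF \<psi>(1) \<phi>(1) \<psi>V R \<zeta>(3)]; assumption)+
  have wU: "w ` R \<subseteq> U"
    using R(2) \<psi>V by (auto simp: w_def)
  have w0: "w 0 = 0"
    using \<psi>(2)[OF UV(3)] by (simp add: w_def \<zeta>(2) UV(5))
  have "\<exists>k\<in>{3, 4}. vanishing_order (\<lambda>t. (w t $ 1) ^ 3 + (w t $ 2) ^ 4) k"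
    using w w0 unfolding holomorphic_arc_def
    by (intro vanishing_order_cubic_plus_quartic[of _ R]) (auto simp: vec_eq_iff forall_2)
  then obtain k where k: "k \<in> {3, 4}" "vanishing_order (\<lambda>t. normal_form E6 (w t)) k"
    by auto
  have "vanishing_order (\<lambda>t. u (w t) * normal_form E6 (w t)) k"
    using u w wU w0 UV(3) k(2) by (intro vanishing_order_unit_mult[of U u R w]) auto
  moreover have "u (w t) * normal_form E6 (w t) = local_equation F v a b (\<zeta> t)" if "t \<in> R" for t
  proof -
    have "\<zeta> t \<in> V" using R(2) that by blast
    then show ?thesis
      using eq[of "w t"] \<psi>V[of "\<zeta> t"] by (simp add: w_def)
  qed
  moreover have "open R" "0 \<in> R"
    using R(1) by (simp_all add: holomorphic_arc_def)
  ultimately have "vanishing_order (\<lambda>t. local_equation F v a b (\<zeta> t)) k"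
    using vanishing_order_cong[of R "\<lambda>t. u (w t) * normal_form E6 (w t)"
        "\<lambda>t. local_equation F v a b (\<zeta> t)"] by simp
  then show ?thesis
    using order k(1) by blast
qed

text \<open>The first axis gives order 2 for \<open>A k\<close> and lies on the curve for
  \<open>D k\<close>; the second axis lies on the curve for \<open>E7\<close> and gives order 5 for
  \<open>E8\<close>.\<close>

lemma normal_form_along_axis:
  assumes "valid_ADE T" "T \<noteq> E6"
  shows "\<exists>j. (\<forall>t. normal_form T (axis j t) = 0) \<or>
             (\<exists>k. k \<notin> {3, 4} \<and> (\<forall>t. normal_form T (axis j t) = t ^ k))"
proof (cases T)
  case (A k)
  then have "\<forall>t. normal_form T (axis 1 t) = t ^ 2"
    by (simp add: axis_def)
  moreover have "2 \<notin> {3, 4 :: nat}" by simp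
  ultimately show ?thesis by blast
next
  case (D k)
  \<comment> \<open>Validity matters here: \<open>k \<ge> 4\<close> makes the exponent
    \<open>k - 1\<close> positive, so the pure power of the second coordinate vanishes instead of
    being 1.\<close>
  with assms have "\<forall>t. normal_form T (axis 1 t) = 0"
    by (simp add: axis_def)
  then show ?thesis by blast
next
  case E7
  then have "\<forall>t. normal_form T (axis 2 t) = 0"
    by (simp add: axis_def)
  then show ?thesis by blast
next
  case E8
  then have "\<forall>t. normal_form T (axis 2 t) = t ^ 5"
    by (simp add: axis_def)
  moreover have "5 \<notin> {3, 4 :: nat}" by simp
  ultimately show ?thesis by blast
qed (use assms in simp)

text \<open>The transport now runs the other way: a coordinate axis of the normal form is sent by
  \<open>\<phi>\<close> into the affine chart and lifted to homogeneous coordinates with first frame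
  coordinate 1. The resulting single arc excludes both orders 3 and 4.\<close>

lemma non_E6_vanishing_order:
  assumes T: "has_ADE_type F p T" "T \<noteq> E6"
  obtains S \<Gamma> where "regular_arc p S \<Gamma>"
    "\<And>k. k \<in> {3, 4} \<Longrightarrow> \<not> vanishing_order (\<lambda>t. poly_eval F (\<Gamma> t)) k"
proof -
  obtain v a b where valid: "valid_ADE T" and p: "p = vec.span {v}"
    and span: "vec.span {v, a, b} = UNIV"
    and equiv: "locally_analytically_equivalent (local_equation F v a b) (normal_form T)"
    using T(1) unfolding has_ADE_type_def by blast
  obtain U V \<phi> u where UV: "open U" "open V" "0 \<in> U" "biholomorphic U V \<phi>" "\<phi> 0 = 0"
    and u: "holomorphic_fun U u" "\<And>z. z \<in> U \<Longrightarrow> u z \<noteq> 0"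
    and eq: "\<And>z. z \<in> U \<Longrightarrow> local_equation F v a b (\<phi> z) = u z * normal_form T z"
    using equiv unfolding locally_analytically_equivalent_def by blast
  obtain \<psi> where \<phi>: "holomorphic_map U \<phi>" "\<phi> ` U = V" and \<psi>: "holomorphic_map V \<psi>"
    "\<And>z. z \<in> U \<Longrightarrow> \<psi> (\<phi> z) = z"
    using UV(4) unfolding biholomorphic_def by blast
  obtain M :: "complex ^ 3 ^ 3" where
    "\<And>x. x = (M *v x) $ 1 *s v + (M *v x) $ 2 *s a + (M *v x) $ 3 *s b" and
    M: "\<And>r s t. M *v (r *s v + s *s a + t *s b) = vector [r, s, t]"
    using projective_frame_coordinates[OF span] by blast
  obtain j where j: "(\<forall>t. normal_form T (axis j t) = 0) \<or>
      (\<exists>k. k \<notin> {3, 4} \<and> (\<forall>t. normal_form T (axis j t) = t ^ k))"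
    using normal_form_along_axis[OF valid T(2)] by blast
  define \<gamma> :: "complex \<Rightarrow> complex ^ 2" where "\<gamma> t = axis j t" for t
  have \<gamma>0: "\<gamma> 0 = 0"
    by (simp add: \<gamma>_def axis_def vec_eq_iff)
  have "(\<lambda>t. \<gamma> t $ i) holomorphic_on UNIV" for i
    by (cases "i = j") (simp_all add: \<gamma>_def axis_def)
  then have arc: "holomorphic_arc UNIV \<gamma>"
    by (simp add: holomorphic_arc_def)
  have "velocity \<gamma> $ j = 1"
    by (simp add: \<gamma>_def axis_def)
  then have vel\<gamma>: "velocity \<gamma> \<noteq> 0"
    by (metis zero_index zero_neq_one)
  define S where "S = UNIV \<inter> \<gamma> -` U"
  have "\<gamma> 0 \<in> U"
    using \<gamma>0 UV(3) by simp
  then have S: "holomorphic_arc S \<gamma>" "\<gamma> ` S \<subseteq> U"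
    unfolding S_def using holomorphic_arc_restrict[OF arc UV(1)] by blast+
  define \<zeta> where "\<zeta> t = \<phi> (\<gamma> t)" for t
  have \<phi>U: "\<phi> z \<in> V \<and> \<psi> (\<phi> z) = z" if "z \<in> U" for z
    using that \<phi> \<psi> by auto
  have \<zeta>: "holomorphic_arc S \<zeta>" "velocity \<zeta> \<noteq> 0"
    unfolding \<zeta>_def by (rule inverse_pair_comp_arc[OF \<phi>(1) \<psi>(1) \<phi>U S vel\<gamma>]; assumption)+
  define \<Gamma> where "\<Gamma> t = v + \<zeta> t $ 1 *s a + \<zeta> t $ 2 *s b" for t
  have \<Gamma>: "holomorphic_arc S \<Gamma>"
    using \<zeta>(1) unfolding holomorphic_arc_def \<Gamma>_def
    by (auto intro!: holomorphic_intros)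
  have "M *v \<Gamma> t = vector [1, \<zeta> t $ 1, \<zeta> t $ 2]" for t
    using M[of 1 "\<zeta> t $ 1" "\<zeta> t $ 2"] by (simp add: \<Gamma>_def)
  \<comment> \<open>In frame coordinates the last two entries of the velocity are those of
    \<open>velocity \<zeta>\<close>. A multiple of \<open>v\<close> would have both of them
    zero.\<close>
  then have vel: "M *v velocity \<Gamma> = velocity (\<lambda>t. vector [1, \<zeta> t $ 1, \<zeta> t $ 2])"
    using holomorphic_arc_matrix_vector_mult(2)[OF \<Gamma>, of M] by simp
  have "velocity \<Gamma> \<notin> vec.span {v}"
  proof
    assume "velocity \<Gamma> \<in> vec.span {v}"
    then obtain r where "velocity \<Gamma> = r *s v"
      by (auto simp: vec.span_singleton)
    then have "velocity (\<lambda>t. vector [1, \<zeta> t $ 1, \<zeta> t $ 2]) = (vector [r, 0, 0] :: complex ^ 3)"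
      using M[of r 0 0] vel by simp
    then show False
      using \<zeta>(2) by (simp add: vec_eq_iff forall_3 forall_2)
  qed
  moreover have "\<Gamma> 0 = v"
    by (simp add: \<Gamma>_def \<zeta>_def \<gamma>0 UV(5))
  moreover have "v \<noteq> 0"
  proof
    assume "v = 0"
    then have "vector [1, 0, 0] = (0 :: complex ^ 3)"
      using M[of 1 0 0] by simp
    then show False
      by (simp add: vec_eq_iff forall_3)
  qed
  ultimately have regular: "regular_arc p S \<Gamma>"
    using \<Gamma> by (simp add: regular_arc_def p vec.span_base)
  have eqS: "poly_eval F (\<Gamma> t) = u (\<gamma> t) * normal_form T (axis j t)" if "t \<in> S" for t
  proof -
    have "\<gamma> t \<in> U" using S(2) that by blast
    from eq[OF this] show ?thesis
      by (simp add: local_equation_def \<Gamma>_def \<zeta>_def) (simp add: \<gamma>_def)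
  qed
  have "open S" "0 \<in> S"
    using S(1) by (simp_all add: holomorphic_arc_def)
  note order_eq = vanishing_order_cong[OF this eqS]
  have "\<not> vanishing_order (\<lambda>t. poly_eval F (\<Gamma> t)) k" if k: "k \<in> {3, 4}" for k
    using j
  proof
    assume "\<forall>t. normal_form T (axis j t) = 0"
    then show ?thesis
      using order_eq not_vanishing_order_0 by simp
  next
    assume "\<exists>k. k \<notin> {3, 4} \<and> (\<forall>t. normal_form T (axis j t) = t ^ k)"
    then obtain l where l: "l \<notin> {3, 4}" "\<And>t. normal_form T (axis j t) = t ^ l"
      by blast
    have "vanishing_order (\<lambda>t. u (\<gamma> t) * t ^ l) l"
      using u S \<gamma>0 UV(3) by (intro vanishing_order_unit_mult vanishing_order_power) auto
    then have "vanishing_order (\<lambda>t. poly_eval F (\<Gamma> t)) l"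
      using order_eq l(2) by simp
    then show ?thesis
      using vanishing_order_unique l(1) k by blast
  qed
  with regular show ?thesis
    using that by blast
qed

section \<open>Uniqueness of the type and the divisibility argument\<close>

text \<open>The definite description in \<open>ADE_type\<close> yields \<open>E6\<close> only once
  every competing type is excluded. A competitor supplies a regular arc at the same \<open>p\<close>
  along which \<open>F\<close> has neither order 3 nor order 4, contradicting the behaviour at an
  \<open>E6\<close> point.\<close>

lemma ADE_type_eq_E6:
  assumes "homogeneous n F" "has_ADE_type F p E6"
  shows "ADE_type F p = E6"
  unfolding ADE_type_def
proof (rule the_equality)
  fix T
  assume T: "has_ADE_type F p T"
  show "T = E6"
  proof (rule ccontr)
    assume "T \<noteq> E6"
    show False
    proof (rule non_E6_vanishing_order[OF T \<open>T \<noteq> E6\<close>])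
      fix S \<Gamma>
      assume "regular_arc p S \<Gamma>"
        and "\<And>k. k \<in> {3, 4} \<Longrightarrow> \<not> vanishing_order (\<lambda>t. poly_eval F (\<Gamma> t)) k"
      then show False
        using E6_vanishing_order[OF assms] by blast
    qed
  qed
qed (fact assms(2))

theorem theorem5p12:
  shows "\<not> (\<exists>(n::nat) (F::3 cpoly).
           n \<in> {6..24} \<and> MK_curve n F \<and> (\<forall>p\<in>Sing F. has_ADE_type F p E6))"
proof clarify
  fix n :: nat and F :: "3 cpoly"
  assume n: "n \<in> {6..24}" and MK: "MK_curve n F" and E6: "\<forall>p\<in>Sing F. has_ADE_type F p E6"
  have "homogeneous n F"
    using MK by (simp add: MK_curve_def reduced_curve_def)
  \<comment> \<open>This also covers an infinite \<open>Sing F\<close>: both the sum and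
    \<open>card\<close> are then 0 by convention.\<close>
  then have "curve_MK_number F = real (card (Sing F)) * (167 / 8)"
    using E6 by (simp add: curve_MK_number_def ADE_type_eq_E6 MK_number_explicit)
  then have "167 * real (card (Sing F)) = 4 * real n * (5 * real n - 6)"
    using MK by (simp add: MK_curve_def)
  \<comment> \<open>The equation is moved to the integers, where divisibility is meaningful and the
    subtraction is not truncated.\<close>
  then have "real_of_int (167 * int (card (Sing F))) = real_of_int (4 * int n * (5 * int n - 6))"
    by simp
  then have "167 * int (card (Sing F)) = 4 * int n * (5 * int n - 6)"
    using of_int_eq_iff by blast
  then have dvd: "167 dvd 4 * int n * (5 * int n - 6)"
    by (metis dvd_triv_left)
  have "prime (167 :: int)"
    by simp
  with dvd have "167 dvd (4 :: int) \<or> 167 dvd int n \<or> 167 dvd 5 * int n - 6"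
    by (simp add: prime_dvd_mult_iff)
  then show False
    using n zdvd_imp_le[of 167 "int n"] zdvd_imp_le[of 167 "5 * int n - 6"] by auto
qed

end
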